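(* Let $\langle\cdot,\cdot\rangle$ be an inner product on $\mathbb{R}^d$ with induced norm $\|\cdot\|$, let $\mathbf{c}\in\mathbb{R}^d$, and let $\emptyset\neq\mathcal{P}\subset\mathbb{R}^d$ be a polytope such that the projection of the origin onto $\mathcal{P}$ is not a minimizer of $\langle\mathbf{c},\mathbf{x}\rangle$ over $\mathbf{x}\in\mathcal{P}$. For $\eta>0$ let $\mathbf{x}^\eta$ be the unique minimizer of $\langle\mathbf{c},\mathbf{x}\rangle+\frac{\|\mathbf{x}\|^2}{\eta}$ over $\mathbf{x}\in\mathcal{P}$, and let $\mathbf{x}^0$ be the unique minimizer of $\|\mathbf{x}\|^2$ over $\mathbf{x}\in\mathcal{P}$. Then $$\|\mathbf{x}^\eta-\mathbf{x}^0\|\le\frac12\|\mathbf{c}\|\,\eta\quad\text{for all }\eta>0.$$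
   Context: A polytope is the convex hull of finitely many points in $\mathbb{R}^d$. Projections are with respect to the norm $\|\cdot\|$. *)

theory Defs
  imports "HOL-Analysis.Analysis"
begin

text \<open>The inner product is an arbitrary one on the fixed vector space, not necessarily the
  type-class inner product; norm and projection are taken with respect to it.\<close>

definition is_inner_product :: "('a::real_vector \<Rightarrow> 'a \<Rightarrow> real) \<Rightarrow> bool" where
  "is_inner_product ip \<longleftrightarrow>
     bilinear ip \<and> (\<forall>x y. ip x y = ip y x) \<and> (\<forall>x. x \<noteq> 0 \<longrightarrow> ip x x > 0)"

definition induced_norm :: "('a::real_vector \<Rightarrow> 'a \<Rightarrow> real) \<Rightarrow> 'a \<Rightarrow> real" where
  "induced_norm ip x = sqrt (ip x x)"

definition is_minimizer_on :: "('a \<Rightarrow> real) \<Rightarrow> 'a set \<Rightarrow> 'a \<Rightarrow> bool" where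
  "is_minimizer_on f S x \<longleftrightarrow> is_arg_min f (\<lambda>y. y \<in> S) x"

definition projection_onto :: "('a::real_vector \<Rightarrow> 'a \<Rightarrow> real) \<Rightarrow> 'a set \<Rightarrow> 'a \<Rightarrow> 'a" where
  "projection_onto ip S a = arg_min_on (\<lambda>y. induced_norm ip (y - a)) S"

definition regularized_objective ::
    "('a::real_vector \<Rightarrow> 'a \<Rightarrow> real) \<Rightarrow> 'a \<Rightarrow> real \<Rightarrow> 'a \<Rightarrow> real" where
  "regularized_objective ip c \<eta> x = ip c x + (induced_norm ip x)\<^sup>2 / \<eta>"

end

theory Submission
  imports Defs
begin

text \<open>Both minimizers are minimizers over a compact convex set of a function
  \<open>\<langle>c,x\<rangle> + t\<parallel>x\<parallel>\<^sup>2\<close> with \<open>t > 0\<close> (taking \<open>c = 0\<close>, \<open>t = 1\<close> for \<open>x\<^sup>0\<close>). Such a minimizer \<open>x\<close> satisfies the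
  variational inequality \<open>\<langle>c + 2tx, y - x\<rangle> \<ge> 0\<close> for all feasible \<open>y\<close>. Adding the inequality for
  \<open>x\<^sup>\<eta>\<close> tested at \<open>x\<^sup>0\<close> to \<open>1/\<eta>\<close> times the one for \<open>x\<^sup>0\<close> tested at \<open>x\<^sup>\<eta>\<close> yields
  \<open>2/\<eta> \<parallel>x\<^sup>\<eta> - x\<^sup>0\<parallel>\<^sup>2 \<le> \<langle>c, x\<^sup>0 - x\<^sup>\<eta>\<rangle>\<close>, and the claim follows by Cauchy-Schwarz.\<close>

lemma is_inner_product_simps:
  assumes "is_inner_product ip"
  shows "ip (x + y) z = ip x z + ip y z" "ip z (x + y) = ip z x + ip z y"
    "ip (x - y) z = ip x z - ip y z" "ip z (x - y) = ip z x - ip z y"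
    "ip (r *\<^sub>R x) z = r * ip x z" "ip z (r *\<^sub>R x) = r * ip z x"
    "ip 0 z = 0" "ip z 0 = 0"
  using assms
  by (auto simp: is_inner_product_def bilinear_ladd bilinear_radd bilinear_lsub bilinear_rsub
      bilinear_lmul bilinear_rmul bilinear_lzero bilinear_rzero)

lemma is_inner_product_commute: "is_inner_product ip \<Longrightarrow> ip x y = ip y x"
  by (simp add: is_inner_product_def)

lemma is_inner_product_self_pos: "is_inner_product ip \<Longrightarrow> x \<noteq> 0 \<Longrightarrow> 0 < ip x x"
  by (simp add: is_inner_product_def)

lemma is_inner_product_self_nonneg: "is_inner_product ip \<Longrightarrow> 0 \<le> ip x x"
  by (cases "x = 0") (auto simp: is_inner_product_simps dest: is_inner_product_self_pos[of ip x])

lemma induced_norm_nonneg: "is_inner_product ip \<Longrightarrow> 0 \<le> induced_norm ip x"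
  by (simp add: induced_norm_def is_inner_product_self_nonneg)

lemma induced_norm_power2: "is_inner_product ip \<Longrightarrow> (induced_norm ip x)\<^sup>2 = ip x x"
  by (simp add: induced_norm_def is_inner_product_self_nonneg)

lemma induced_norm_minus_commute:
  "is_inner_product ip \<Longrightarrow> induced_norm ip (x - y) = induced_norm ip (y - x)"
  by (simp add: induced_norm_def is_inner_product_simps)

lemma inner_product_le_induced_norm:
  assumes ip: "is_inner_product ip"
  shows "ip x y \<le> induced_norm ip x * induced_norm ip y"
proof (cases "y = 0")
  case True
  then show ?thesis using ip by (simp add: is_inner_product_simps induced_norm_def)
next
  case False
  \<comment> \<open>\<open>?z\<close> is \<open>ip y y\<close> times the component of
    \<open>x\<close> orthogonal to \<open>y\<close>; the scaling avoids division. Its square is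
    \<open>ip y y\<close> times the Gram determinant of \<open>x\<close> and \<open>y\<close>, which
    is therefore nonnegative.\<close>
  let ?z = "ip y y *\<^sub>R x - ip x y *\<^sub>R y"
  have pos: "0 < ip y y" using is_inner_product_self_pos[OF ip False] .
  have "0 \<le> ip ?z ?z" by (rule is_inner_product_self_nonneg[OF ip])
  also have "\<dots> = ip y y * (ip x x * ip y y - (ip x y)\<^sup>2)"
    using is_inner_product_commute[OF ip, of y x]
    by (simp add: is_inner_product_simps[OF ip] algebra_simps power2_eq_square)
  finally have "(ip x y)\<^sup>2 \<le> ip x x * ip y y"
    using pos by (simp add: zero_le_mult_iff)
  then have "ip x y \<le> sqrt (ip x x * ip y y)"
    by (rule real_le_rsqrt)
  then show ?thesis by (simp add: induced_norm_def real_sqrt_mult)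
qed

text \<open>First-order optimality: a step of size \<open>s\<close> from \<open>x\<close> towards
  \<open>y\<close> stays in \<open>S\<close> by convexity and changes the objective by
  \<open>s * (g + s * k)\<close>. A negative slope \<open>g\<close> would make this negative for
  small \<open>s\<close>.\<close>

lemma minimizer_variational_inequality:
  assumes ip: "is_inner_product ip" and "convex S"
    and min: "is_minimizer_on (\<lambda>x. ip c x + t * ip x x) S x" and "y \<in> S" and "0 < t"
  shows "0 \<le> ip c (y - x) + 2 * t * ip x (y - x)"
proof (rule ccontr)
  let ?d = "y - x"
  define g where "g = ip c ?d + 2 * t * ip x ?d"
  define k where "k = t * ip ?d ?d"
  assume "\<not> ?thesis"
  then have g: "g < 0" by (simp add: g_def)
  have k: "0 \<le> k" using is_inner_product_self_nonneg[OF ip, of ?d] \<open>0 < t\<close> by (simp add: k_def)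
  have x: "x \<in> S" using min by (simp add: is_minimizer_on_def is_arg_min_def)
  \<comment> \<open>The bound 1 keeps the point on the segment; the other bound gives
    \<open>s * k \<le> - g / 2\<close>, hence \<open>g + s * k \<le> g / 2 < 0\<close>. Using
    \<open>k + 1\<close> covers \<open>k = 0\<close>.\<close>
  define s where "s = min 1 (- g / (2 * (k + 1)))"
  have s: "0 < s" "s \<le> 1" using g k by (auto simp: s_def intro!: divide_neg_pos)
  have "(1 - s) *\<^sub>R x + s *\<^sub>R y \<in> S"
    using \<open>convex S\<close> x \<open>y \<in> S\<close> s by (simp add: convex_alt)
  also have "(1 - s) *\<^sub>R x + s *\<^sub>R y = x + s *\<^sub>R ?d" by (simp add: algebra_simps)
  finally have "ip c x + t * ip x x \<le> ip c (x + s *\<^sub>R ?d) + t * ip (x + s *\<^sub>R ?d) (x + s *\<^sub>R ?d)"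
    using min by (auto simp: is_minimizer_on_def is_arg_min_linorder)
  also have "\<dots> = ip c x + t * ip x x + s * (g + s * k)"
    using is_inner_product_commute[OF ip, of y x]
    by (simp add: is_inner_product_simps[OF ip] g_def k_def algebra_simps)
  finally have "0 \<le> g + s * k" using s by (simp add: zero_le_mult_iff)
  moreover have "s * k \<le> - g / (2 * (k + 1)) * (k + 1)"
    using s g k by (intro mult_mono) (auto simp: s_def divide_nonneg_pos)
  moreover have "- g / (2 * (k + 1)) * (k + 1) = - g / 2"
    using k by (simp add: field_simps)
  ultimately show False using g by simp
qed

lemma ex1_minimizer_quadratic:
  fixes ip :: "'a::euclidean_space \<Rightarrow> 'a \<Rightarrow> real"
  assumes ip: "is_inner_product ip" and "convex S" "compact S" "S \<noteq> {}" and "0 < t"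
  shows "\<exists>!x. is_minimizer_on (\<lambda>x. ip c x + t * ip x x) S x"
proof -
  let ?f = "\<lambda>x. ip c x + t * ip x x"
  \<comment> \<open>In finite dimension any bilinear form is bounded, so the objective is continuous
    for the standard topology, in which \<open>S\<close> is compact.\<close>
  interpret bounded_bilinear ip
    using ip by (simp add: is_inner_product_def bilinear_conv_bounded_bilinear)
  have "continuous_on S ?f" by (intro continuous_intros continuous_on)
  then obtain x where x: "x \<in> S" "\<forall>y\<in>S. ?f x \<le> ?f y"
    using continuous_attains_inf[OF \<open>compact S\<close> \<open>S \<noteq> {}\<close>] by blast
  show ?thesis
  proof
    show "is_minimizer_on ?f S x"
      using x by (auto simp: is_minimizer_on_def is_arg_min_linorder)
  next
    fix y assume y: "is_minimizer_on ?f S y"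
    then have yS: "y \<in> S" by (simp add: is_minimizer_on_def is_arg_min_def)
    have mx: "is_minimizer_on ?f S x"
      using x by (auto simp: is_minimizer_on_def is_arg_min_linorder)
    \<comment> \<open>Each minimizer is tested against the other; in the sum the terms in
      \<open>c\<close> cancel and only a negative multiple of the squared distance remains.\<close>
    have "0 \<le> ip c (y - x) + 2 * t * ip x (y - x) + (ip c (x - y) + 2 * t * ip y (x - y))"
      using minimizer_variational_inequality[OF ip \<open>convex S\<close> mx yS \<open>0 < t\<close>]
        minimizer_variational_inequality[OF ip \<open>convex S\<close> y x(1) \<open>0 < t\<close>] by simp
    also have "\<dots> = - (2 * t * ip (y - x) (y - x))"
      by (simp add: is_inner_product_simps[OF ip] algebra_simps)
    finally have "ip (y - x) (y - x) \<le> 0"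
      using \<open>0 < t\<close> by (simp add: mult_le_0_iff)
    then show "y = x"
      using is_inner_product_self_pos[OF ip, of "y - x"] by fastforce
  qed
qed

lemma minimizer_quadratic_distance_le:
  assumes ip: "is_inner_product ip" and "convex S" and "0 < \<eta>"
    and x: "is_minimizer_on (\<lambda>x. ip c x + (1 / \<eta>) * ip x x) S x"
    and z: "is_minimizer_on (\<lambda>x. ip 0 x + 1 * ip x x) S z"
  shows "induced_norm ip (x - z) \<le> 1 / 2 * induced_norm ip c * \<eta>"
proof -
  let ?n = "induced_norm ip (z - x)"
  have S: "x \<in> S" "z \<in> S" using x z by (simp_all add: is_minimizer_on_def is_arg_min_def)
  have "0 \<le> ip c (z - x) + 2 * (1 / \<eta>) * ip x (z - x)"
    using minimizer_variational_inequality[OF ip \<open>convex S\<close> x S(2)] \<open>0 < \<eta>\<close> by simp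
  then have "0 \<le> \<eta> * (ip c (z - x) + 2 * (1 / \<eta>) * ip x (z - x))"
    using \<open>0 < \<eta>\<close> by simp
  also have "\<dots> = \<eta> * ip c (z - x) + 2 * ip x (z - x)"
    using \<open>0 < \<eta>\<close> by (simp add: field_simps)
  finally have "0 \<le> \<eta> * ip c (z - x) + 2 * ip x (z - x)" .
  moreover have "0 \<le> 2 * ip z (x - z)"
    using minimizer_variational_inequality[OF ip \<open>convex S\<close> z S(1)]
    by (simp add: is_inner_product_simps[OF ip])
  ultimately have "2 * ip (z - x) (z - x) \<le> \<eta> * ip c (z - x)"
    by (simp add: is_inner_product_simps[OF ip] algebra_simps)
  also have "\<dots> \<le> \<eta> * (induced_norm ip c * ?n)"
    using inner_product_le_induced_norm[OF ip] \<open>0 < \<eta>\<close> by simp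
  finally have "(2 * ?n) * ?n \<le> (\<eta> * induced_norm ip c) * ?n"
    by (simp add: induced_norm_power2[OF ip, symmetric] power2_eq_square mult_ac)
  \<comment> \<open>Cancel the common factor \<open>?n\<close>; if it vanishes, the bound holds
    because its right side is nonnegative.\<close>
  then have "2 * ?n \<le> \<eta> * induced_norm ip c"
    using induced_norm_nonneg[OF ip, of "z - x"] induced_norm_nonneg[OF ip, of c] \<open>0 < \<eta>\<close>
    by (cases "?n = 0") auto
  then show ?thesis
    by (simp add: induced_norm_minus_commute[OF ip, of x z] mult_ac)
qed

theorem proposition2p7:
  fixes ip :: "real ^ 'n \<Rightarrow> real ^ 'n \<Rightarrow> real"
    and c :: "real ^ 'n"
    and P :: "(real ^ 'n) set"
  assumes "is_inner_product ip"
    and "polytope P"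
    and "P \<noteq> {}"
    and "\<not> is_minimizer_on (\<lambda>x. ip c x) P (projection_onto ip P 0)"
  shows "(\<exists>!x. is_minimizer_on (\<lambda>x. (induced_norm ip x)\<^sup>2) P x) \<and>
    (\<forall>\<eta>>0. \<exists>!x. is_minimizer_on (regularized_objective ip c \<eta>) P x) \<and>
    (\<forall>\<eta>>0. induced_norm ip
        (arg_min_on (regularized_objective ip c \<eta>) P
          - arg_min_on (\<lambda>x. (induced_norm ip x)\<^sup>2) P)
      \<le> 1 / 2 * induced_norm ip c * \<eta>)"
proof -
  note ip = assms(1)
  have P: "convex P" "compact P"
    using assms(2) by (simp_all add: polytope_imp_convex polytope_imp_compact)
  have x0: "(\<lambda>x. (induced_norm ip x)\<^sup>2) = (\<lambda>x. ip 0 x + 1 * ip x x)"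
    by (simp add: induced_norm_power2[OF ip] is_inner_product_simps[OF ip])
  have x\<eta>: "regularized_objective ip c \<eta> = (\<lambda>x. ip c x + (1 / \<eta>) * ip x x)" for \<eta>
    by (simp add: fun_eq_iff regularized_objective_def induced_norm_power2[OF ip])
  \<comment> \<open>\<open>arg_min_on\<close> is a Hilbert choice, so it is a genuine minimizer only
    once existence is known.\<close>
  have arg_min: "is_minimizer_on f P (arg_min_on f P)"
    if "\<exists>!x. is_minimizer_on f P x" for f :: "real ^ 'n \<Rightarrow> real"
    using that unfolding is_minimizer_on_def arg_min_on_def arg_min_def by (metis someI)
  have ex0: "\<exists>!x. is_minimizer_on (\<lambda>x. (induced_norm ip x)\<^sup>2) P x"
    unfolding x0 by (rule ex1_minimizer_quadratic[OF ip P assms(3)]) simp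
  have ex\<eta>: "\<exists>!x. is_minimizer_on (regularized_objective ip c \<eta>) P x" if "0 < \<eta>" for \<eta>
    unfolding x\<eta> using that by (intro ex1_minimizer_quadratic[OF ip P assms(3)]) simp
  show ?thesis
    using ex0 ex\<eta>
      minimizer_quadratic_distance_le[OF ip P(1) _ arg_min[OF ex\<eta>, unfolded x\<eta>]
        arg_min[OF ex0, unfolded x0], folded x\<eta> x0]
    by blast
qed

end
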